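(* Let $m\ge1$, $n_1,\dots,n_m\ge1$, and $\mathbb{X}=\biguplus_{r=1}^{m}\{r\}\times\mathbb{R}^{n_r}$. Suppose the predicted density on $\mathbb{X}$ at time $k$ is $f_{k|k-1}(r_k,x_k)=f_{k|k-1}(r_k)f_{k|k-1}(x_k|r_k)$ with $$f_{k|k-1}(x_k|r_k)=\mathcal{N}\big(x_k;\overline{x}_{k|k-1}^{(r_k)},P_{k|k-1}^{(r_k)}\big)$$ for each mode $r_k$, and that the measurement $z_k\in\mathbb{R}^{n_z}$ has likelihood $$l(z_k|r_k,x_k)=\mathcal{N}\big(z_k;H^{(r_k)}x_k+d^{(r_k)},R^{(r_k)}\big).$$ Then the updated (posterior) density is $f_{k|k}(r_k,x_k)=f_{k|k}(r_k)f_{k|k}(x_k|r_k)$ with $f_{k|k}(x_k|r_k)=\mathcal{N}\big(x_k;\overline{x}_{k|k}^{(r_k)},P_{k|k}^{(r_k)}\big)$, where $$\overline{x}_{k|k}^{(r_k)}=\overline{x}_{k|k-1}^{(r_k)}+P_{k|k-1}^{(r_k)}\big(H^{(r_k)}\big)^{T}\big(S^{(r_k)}\big)^{-1}\big(z_k-\hat z^{(r_k)}\big),$$ $$P_{k|k}^{(r_k)}=P_{k|k-1}^{(r_k)}-P_{k|k-1}^{(r_k)}\big(H^{(r_k)}\big)^{T}\big(S^{(r_k)}\big)^{-1}H^{(r_k)}P_{k|k-1}^{(r_k)},$$ $$\hat z^{(r_k)}=H^{(r_k)}\overline{x}_{k|k-1}^{(r_k)}+d^{(r_k)},\qquad S^{(r_k)}=H^{(r_k)}P_{k|k-1}^{(r_k)}\big(H^{(r_k)}\big)^{T}+R^{(r_k)},$$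 and the posterior of the mode is $$f_{k|k}(r_k)=\frac{f_{k|k-1}(r_k)\,\mathcal{N}\big(z_k;\hat z^{(r_k)},S^{(r_k)}\big)}{\sum_{r=1}^{m}f_{k|k-1}(r)\,\mathcal{N}\big(z_k;\hat z^{(r)},S^{(r)}\big)}.$$
   Context: The target state is $\tilde x=(r,x)\in\mathbb{X}$ with mode $r\in\{1,\dots,m\}$ and kinematic state $x\in\mathbb{R}^{n_r}$; the dimensions $n_r$ may differ between modes. The integral of a function $g$ on $\mathbb{X}$ is $\int_{\mathbb{X}}g(\tilde x)\,d\tilde x=\sum_{r=1}^m\int_{\mathbb{R}^{n_r}}g(r,x)\,dx$. A density on $\mathbb{X}$ is a nonnegative function with integral one; $g(r)=\int g(r,x)\,dx$ is its mode marginal and $g(x|r)=g(r,x)/g(r)$ the conditional density of the state given the mode (formulas conditioned on $r_k$ are asserted for modes with $f_{k|k-1}(r_k)>0$). $\mathcal{N}(x;\bar x,P)$ denotes the Gaussian density with mean $\bar x$ and covariance matrix $P$ (symmetric positive definite) evaluated at $x$. $H^{(r)}\in\mathbb{R}^{n_z\times n_r}$, $d^{(r)}\in\mathbb{R}^{n_z}$, $R^{(r)}\in\mathbb{R}^{n_z\times n_z}$. The posterior density is defined by Bayes' rule on $\mathbb{X}$: $f_{k|k}(r_k,x_k)=\dfrac{l(z_k|r_k,x_k)f_{k|k-1}(r_k,x_k)}{\sum_{r=1}^m\int_{\mathbb{R}^{n_r}}l(z_k|r,x)f_{k|k-1}(r,x)\,dx}$. *)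

theory Defs
  imports
    "HOL-Analysis.Analysis"
    "Jordan_Normal_Form.Determinant"
    "Jordan_Normal_Form.Gauss_Jordan_Elimination"
begin

text \<open>
  The state dimension depends on the mode, so points of $R^n$ are elements of
  \<^term>\<open>carrier_vec n\<close> and a function on the hybrid space is a curried function
  \<open>g r x\<close>, of which only the values at \<open>r \<in> {1..m}\<close>, \<open>x \<in> carrier_vec (n r)\<close> are relevant.
  Constants that also exist in HOL-Analysis (\<open>vec\<close>, \<open>det\<close>) are written qualified.
\<close>

text \<open>Lebesgue measure on \<^term>\<open>carrier_vec n\<close>, transported from the n-fold product of the real line.\<close>

definition lborel_vec :: "nat \<Rightarrow> real Matrix.vec measure" where
  "lborel_vec n = embed_measure (\<Pi>\<^sub>M i\<in>{..<n}. (lborel :: real measure)) (Matrix.vec n)"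

lemma space_PiM_lborel:
  "space (\<Pi>\<^sub>M i\<in>{..<n}. (lborel :: real measure)) = {..<n} \<rightarrow>\<^sub>E UNIV"
  by (simp only: space_PiM space_lborel space_borel)

lemma inj_on_vec_PiM:
  "inj_on (Matrix.vec n) (space (\<Pi>\<^sub>M i\<in>{..<n}. (lborel :: real measure)))"
  unfolding space_PiM_lborel
proof (rule inj_onI)
  fix f g :: "nat \<Rightarrow> real"
  assume f: "f \<in> {..<n} \<rightarrow>\<^sub>E UNIV" and g: "g \<in> {..<n} \<rightarrow>\<^sub>E UNIV"
    and eq: "Matrix.vec n f = Matrix.vec n g"
  show "f = g"
  proof (rule PiE_ext[OF f g])
    fix i assume "i \<in> {..<n}"
    then have i: "i < n" by simp
    show "f i = g i"
      using arg_cong[OF eq, of "\<lambda>v. vec_index v i"] unfolding index_vec[OF i] .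
  qed
qed

lemma space_lborel_vec: "space (lborel_vec n) = carrier_vec n"
  unfolding lborel_vec_def space_embed_measure space_PiM_lborel
proof (intro equalityI subsetI)
  fix v :: "real Matrix.vec"
  assume "v \<in> carrier_vec n"
  then have "v = Matrix.vec n (restrict (vec_index v) {..<n})"
    by (intro eq_vecI) simp_all
  moreover have "restrict (vec_index v) {..<n} \<in> {..<n} \<rightarrow>\<^sub>E UNIV"
    by (rule restrict_PiE_iff[THEN iffD2]) simp
  ultimately show "v \<in> Matrix.vec n ` ({..<n} \<rightarrow>\<^sub>E UNIV)"
    by (rule image_eqI)
next
  fix v :: "real Matrix.vec"
  assume "v \<in> Matrix.vec n ` ({..<n} \<rightarrow>\<^sub>E UNIV)"
  then obtain f where "v = Matrix.vec n f" by (rule imageE)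
  then show "v \<in> carrier_vec n" by simp
qed

lemma integral_lborel_vec:
  fixes g :: "real Matrix.vec \<Rightarrow> real"
  assumes g: "g \<in> borel_measurable (lborel_vec n)"
  shows "(LINT x|lborel_vec n. g x) =
    (LINT y|(\<Pi>\<^sub>M i\<in>{..<n}. (lborel :: real measure)). g (Matrix.vec n y))"
proof -
  let ?M = "\<Pi>\<^sub>M i\<in>{..<n}. (lborel :: real measure)"
  have "(LINT x|lborel_vec n. g x) = (LINT x|distr ?M (lborel_vec n) (Matrix.vec n). g x)"
    by (rule arg_cong[where f = "\<lambda>M. LINT x|M. g x"])
      (rule embed_measure_eq_distr'[OF inj_on_vec_PiM, folded lborel_vec_def])
  also have "\<dots> = (LINT y|?M. g (Matrix.vec n y))"
    by (rule integral_distr[OF _ g])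
      (rule measurable_embed_measure2'[OF inj_on_vec_PiM, folded lborel_vec_def])
  finally show ?thesis .
qed

definition sym_pos_def_mat :: "nat \<Rightarrow> real mat \<Rightarrow> bool" where
  "sym_pos_def_mat n A \<longleftrightarrow>
     A \<in> carrier_mat n n \<and> transpose_mat A = A \<and>
     (\<forall>v\<in>carrier_vec n. v \<noteq> 0\<^sub>v n \<longrightarrow> scalar_prod v (A *\<^sub>v v) > 0)"

text \<open>Only meaningful for invertible matrices, where \<^const>\<open>mat_inverse\<close> is not \<^const>\<open>None\<close>.\<close>

definition mat_inv :: "real mat \<Rightarrow> real mat" where
  "mat_inv A = the (mat_inverse A)"

definition gaussian :: "real Matrix.vec \<Rightarrow> real Matrix.vec \<Rightarrow> real mat \<Rightarrow> real" where
  "gaussian x \<mu> P =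
     exp (- (1 / 2) * scalar_prod (x - \<mu>) (mat_inv P *\<^sub>v (x - \<mu>)))
     / sqrt ((2 * pi) ^ dim_row P * Determinant.det P)"

definition mode_marginal :: "(nat \<Rightarrow> nat) \<Rightarrow> (nat \<Rightarrow> real Matrix.vec \<Rightarrow> real) \<Rightarrow> nat \<Rightarrow> real" where
  "mode_marginal n g r = (LINT x|lborel_vec (n r). g r x)"

definition state_conditional ::
    "(nat \<Rightarrow> nat) \<Rightarrow> (nat \<Rightarrow> real Matrix.vec \<Rightarrow> real) \<Rightarrow> nat \<Rightarrow> real Matrix.vec \<Rightarrow> real" where
  "state_conditional n g r x = g r x / mode_marginal n g r"

definition hybrid_integral :: "nat \<Rightarrow> (nat \<Rightarrow> nat) \<Rightarrow> (nat \<Rightarrow> real Matrix.vec \<Rightarrow> real) \<Rightarrow> real" where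
  "hybrid_integral m n g = (\<Sum>r=1..m. LINT x|lborel_vec (n r). g r x)"

text \<open>Integrability is explicit because the Bochner integral of a non-integrable function is 0.\<close>

definition hybrid_density :: "nat \<Rightarrow> (nat \<Rightarrow> nat) \<Rightarrow> (nat \<Rightarrow> real Matrix.vec \<Rightarrow> real) \<Rightarrow> bool" where
  "hybrid_density m n g \<longleftrightarrow>
     (\<forall>r\<in>{1..m}. (\<forall>x\<in>carrier_vec (n r). 0 \<le> g r x) \<and> integrable (lborel_vec (n r)) (g r)) \<and>
     hybrid_integral m n g = 1"

definition bayes_posterior ::
    "nat \<Rightarrow> (nat \<Rightarrow> nat) \<Rightarrow> (nat \<Rightarrow> real Matrix.vec \<Rightarrow> real) \<Rightarrow> (nat \<Rightarrow> real Matrix.vec \<Rightarrow> real)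
     \<Rightarrow> nat \<Rightarrow> real Matrix.vec \<Rightarrow> real" where
  "bayes_posterior m n lz f r x = lz r x * f r x / hybrid_integral m n (\<lambda>r x. lz r x * f r x)"

end

theory Submission
  imports Defs "HOL-Probability.Distributions"
begin

text \<open>
  Write \<open>e = x - xp\<close>, \<open>v = z - z_hat\<close>, \<open>s = S\<inverse> v\<close> and \<open>w = e - P H\<^sup>T s\<close>. Then \<open>e = P H\<^sup>T s + w\<close> and
  \<open>v - H e = R s - H w\<close>; when the exponents of prior and likelihood are expanded in \<open>s\<close> and \<open>w\<close>,
  the mixed terms cancel, leaving the exponents of \<open>N(z; z_hat, S)\<close> and of a Gaussian in \<open>x\<close> whose
  precision matrix \<open>H\<^sup>T R\<inverse> H + P\<inverse>\<close> is the inverse of the posterior covariance. Sylvester's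
  determinant identity matches the normalizing constants, so the identity of densities holds
  pointwise, and the theorem follows by integrating it mode by mode. That a Gaussian density
  integrates to 1 is proved by induction on the dimension, splitting off one coordinate with a
  Schur complement.
\<close>

section \<open>Gaussian integrals\<close>

lemma scalar_prod_mult_mat_vec_eq_sum:
  fixes A :: "real mat"
  assumes "A \<in> carrier_mat n n" "v \<in> carrier_vec n"
  shows "scalar_prod v (A *\<^sub>v v) = (\<Sum>i<n. \<Sum>j<n. A $$ (i, j) * vec_index v i * vec_index v j)"
  using assms
  by (auto simp: scalar_prod_def atLeast0LessThan sum_distrib_left intro!: sum.cong)

lemma sym_pos_def_mat_index_sym:
  assumes "sym_pos_def_mat n A" "i < n" "j < n"
  shows "A $$ (i, j) = A $$ (j, i)"
  using assms unfolding sym_pos_def_mat_def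
  by (metis carrier_matD index_transpose_mat(1))

lemma sym_pos_def_mat_sum_pos:
  assumes A: "sym_pos_def_mat n A" and i: "i < n" "x i \<noteq> 0"
  shows "(\<Sum>i<n. \<Sum>j<n. A $$ (i, j) * x i * x j) > 0"
proof -
  have "Matrix.vec n x \<noteq> 0\<^sub>v n" using i by (metis index_vec index_zero_vec(1))
  then have "scalar_prod (Matrix.vec n x) (A *\<^sub>v Matrix.vec n x) > 0"
    using A by (auto simp: sym_pos_def_mat_def)
  also have "scalar_prod (Matrix.vec n x) (A *\<^sub>v Matrix.vec n x)
      = (\<Sum>i<n. \<Sum>j<n. A $$ (i, j) * x i * x j)"
    using A by (subst scalar_prod_mult_mat_vec_eq_sum[where n = n]) (auto simp: sym_pos_def_mat_def)
  finally show ?thesis .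
qed

lemma sym_pos_def_mat_diag_pos:
  assumes A: "sym_pos_def_mat n A" and i: "i < n"
  shows "A $$ (i, i) > 0"
proof -
  \<comment> \<open>The form is evaluated at the \<open>i\<close>-th unit vector, where only the
    diagonal entry survives.\<close>
  have "0 < (\<Sum>k<n. \<Sum>j<n. A $$ (k, j) * (if k = i then 1 else 0) * (if j = i then 1 else 0))"
    by (rule sym_pos_def_mat_sum_pos[OF A i]) simp
  also have "\<dots> = (\<Sum>k<n. if k = i then A $$ (k, i) else 0)"
    using i by (intro sum.cong refl) (auto simp: if_distrib[of "\<lambda>t. _ * t"] cong: if_cong)
  also have "\<dots> = A $$ (i, i)" using i by simp
  finally show ?thesis .
qed

text \<open>Intended for a matrix of size \<open>Suc n\<close>: the complement is taken with respect
  to the last diagonal entry, at index \<open>n\<close>, which must be nonzero to be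
  meaningful.\<close>

definition schur_complement :: "nat \<Rightarrow> real mat \<Rightarrow> real mat" where
  "schur_complement n A = Matrix.mat n n (\<lambda>(i, j). A $$ (i, j) - A $$ (i, n) * A $$ (n, j) / A $$ (n, n))"

lemma schur_complement_carrier [simp]: "schur_complement n A \<in> carrier_mat n n"
  by (simp add: schur_complement_def)

text \<open>Completing the square in the last variable: by symmetry the last row and the last column
  contribute the same linear term, and the square subtracts exactly the rank-one correction
  contained in the Schur complement.\<close>

lemma sum_eq_schur_complement:
  assumes sym: "\<And>i. i < n \<Longrightarrow> A $$ (i, n) = A $$ (n, i)" and c: "A $$ (n, n) \<noteq> (0 :: real)"
  shows "(\<Sum>i<Suc n. \<Sum>j<Suc n. A $$ (i, j) * x i * x j) =
    (\<Sum>i<n. \<Sum>j<n. schur_complement n A $$ (i, j) * x i * x j) +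
    A $$ (n, n) * (x n + (\<Sum>j<n. A $$ (n, j) * x j) / A $$ (n, n))\<^sup>2"
proof -
  define b where "b = (\<Sum>j<n. A $$ (n, j) * x j)"
  define Q where "Q = (\<Sum>i<n. \<Sum>j<n. A $$ (i, j) * x i * x j)"
  have col: "(\<Sum>i<n. A $$ (i, n) * x i * x n) = b * x n"
    unfolding b_def sum_distrib_right by (intro sum.cong refl) (simp add: sym)
  have row: "(\<Sum>j<n. A $$ (n, j) * x n * x j) = b * x n"
    unfolding b_def sum_distrib_right by (intro sum.cong refl) simp
  have L: "(\<Sum>i<Suc n. \<Sum>j<Suc n. A $$ (i, j) * x i * x j) = Q + 2 * b * x n + A $$ (n, n) * (x n)\<^sup>2"
    by (simp add: sum.distrib col row Q_def power2_eq_square)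
  have "(\<Sum>i<n. \<Sum>j<n. schur_complement n A $$ (i, j) * x i * x j)
      = (\<Sum>i<n. \<Sum>j<n. A $$ (i, j) * x i * x j - (A $$ (n, i) * x i) * (A $$ (n, j) * x j) / A $$ (n, n))"
    by (intro sum.cong refl) (simp add: schur_complement_def sym algebra_simps)
  also have "\<dots> = Q - b * b / A $$ (n, n)"
    by (simp add: sum_subtractf Q_def b_def sum_product sum_divide_distrib)
  finally show ?thesis
    unfolding L b_def[symmetric] by (rule ssubst) (use c in \<open>simp add: field_simps power2_eq_square\<close>)
qed

lemma sym_pos_def_mat_schur_complement:
  assumes A: "sym_pos_def_mat (Suc n) A"
  shows "sym_pos_def_mat n (schur_complement n A)"
  unfolding sym_pos_def_mat_def
proof (intro conjI ballI impI)
  note sym = sym_pos_def_mat_index_sym[OF A]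
  have c: "A $$ (n, n) > 0" by (rule sym_pos_def_mat_diag_pos[OF A]) simp
  show "transpose_mat (schur_complement n A) = schur_complement n A"
    proof (rule eq_matI)
    fix i j assume "i < dim_row (schur_complement n A)" "j < dim_col (schur_complement n A)"
    then have ij: "i < n" "j < n" by (simp_all add: schur_complement_def)
    then show "transpose_mat (schur_complement n A) $$ (i, j) = schur_complement n A $$ (i, j)"
      using sym[of j i] sym[of n i] sym[of j n] by (simp add: schur_complement_def)
  qed (simp_all add: schur_complement_def)
  fix v :: "real Matrix.vec"
  assume v: "v \<in> carrier_vec n" "v \<noteq> 0\<^sub>v n"
  then obtain k where k: "k < n" "vec_index v k \<noteq> 0" by (metis carrier_vecD eq_vecI index_zero_vec)
  \<comment> \<open>The last coordinate is the one that makes the completed square vanish, so the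
    form of \<open>A\<close> at \<open>x\<close> equals the form of the Schur complement at
    \<open>v\<close>.\<close>
  define x where "x i = (if i < n then vec_index v i
      else - (\<Sum>j<n. A $$ (n, j) * vec_index v j) / A $$ (n, n))" for i
  have "0 < (\<Sum>i<Suc n. \<Sum>j<Suc n. A $$ (i, j) * x i * x j)"
    using k by (intro sym_pos_def_mat_sum_pos[OF A, of k]) (auto simp: x_def)
  also have "\<dots> = (\<Sum>i<n. \<Sum>j<n. schur_complement n A $$ (i, j) * x i * x j)"
  proof (subst sum_eq_schur_complement)
    show "A $$ (i, n) = A $$ (n, i)" if "i < n" for i using that by (intro sym) simp_all
  qed (use c in \<open>auto simp: x_def\<close>)
  also have "\<dots> = scalar_prod v (schur_complement n A *\<^sub>v v)"
    using v by (subst scalar_prod_mult_mat_vec_eq_sum[where n = n]) (auto simp: x_def)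
  finally show "0 < scalar_prod v (schur_complement n A *\<^sub>v v)" .
qed simp

text \<open>Block elimination of the last column writes \<open>A\<close> as \<open>U * L\<close>
  with \<open>U\<close> unit upper triangular and \<open>L\<close> block lower triangular, so the
  determinant can be read off the diagonal blocks of \<open>L\<close>.\<close>

lemma det_schur_complement:
  assumes A: "A \<in> carrier_mat (Suc n) (Suc n)" and c: "A $$ (n, n) \<noteq> (0 :: real)"
  shows "Determinant.det A = Determinant.det (schur_complement n A) * A $$ (n, n)"
proof -
  define U where "U = four_block_mat (1\<^sub>m n) (Matrix.mat n 1 (\<lambda>(i, j). A $$ (i, n) / A $$ (n, n)))
    (0\<^sub>m 1 n) (1\<^sub>m 1)"
  define L where "L = four_block_mat (schur_complement n A) (0\<^sub>m n 1)
    (Matrix.mat 1 n (\<lambda>(i, j). A $$ (n, j))) (Matrix.mat 1 1 (\<lambda>_. A $$ (n, n)))"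
  have "U * L = A"
    unfolding U_def L_def using A c
    by (subst mult_four_block_mat[of _ n n _ 1 _ 1 _ _ n _ 1])
      (auto intro!: eq_matI simp: schur_complement_def scalar_prod_def not_less less_Suc_eq)
  moreover have "Determinant.det U = 1"
    unfolding U_def by (subst det_four_block_mat_lower_left_zero[of _ n _ 1]) auto
  moreover have "Determinant.det L = Determinant.det (schur_complement n A) * A $$ (n, n)"
    unfolding L_def by (subst det_four_block_mat_upper_right_zero[of _ n _ 1]) (auto simp: det_single)
  moreover have "U \<in> carrier_mat (Suc n) (Suc n)" "L \<in> carrier_mat (Suc n) (Suc n)"
    using four_block_carrier_mat[of "1\<^sub>m n" n n "1\<^sub>m 1" 1 1]
    using four_block_carrier_mat[of "schur_complement n A" n n "Matrix.mat 1 1 (\<lambda>_. A $$ (n, n))" 1 1]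
    by (auto simp: U_def L_def)
  ultimately show ?thesis using det_mult[of U "Suc n" L] by simp
qed

text \<open>The determinant is the product of the successive pivots, each of which is a diagonal
  entry of a positive definite matrix.\<close>

lemma sym_pos_def_mat_det_pos: "sym_pos_def_mat n A \<Longrightarrow> Determinant.det A > 0"
proof (induction n arbitrary: A)
  case 0
  then show ?case by (simp add: sym_pos_def_mat_def)
next
  case (Suc n)
  have "A $$ (n, n) > 0" by (rule sym_pos_def_mat_diag_pos[OF Suc.prems]) simp
  moreover have "A \<in> carrier_mat (Suc n) (Suc n)" using Suc.prems by (simp add: sym_pos_def_mat_def)
  ultimately show ?case
    using Suc.IH[OF sym_pos_def_mat_schur_complement[OF Suc.prems]] det_schur_complement[of A n] by simp
qed

section \<open>The integral of the exponential of a negative definite quadratic form\<close>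

lemma nn_integral_exp_neg_square:
  assumes "c > 0"
  shows "(\<integral>\<^sup>+t. ennreal (exp (- (1 / 2) * (c * (t - s)\<^sup>2))) \<partial>lborel) = ennreal (sqrt (2 * pi / c))"
proof -
  \<comment> \<open>Up to the factor \<open>sqrt (2 * pi / c)\<close> the integrand is the normal
    density with mean \<open>s\<close> and variance \<open>1 / c\<close>.\<close>
  define \<sigma> where "\<sigma> = 1 / sqrt c"
  have \<sigma>: "\<sigma> > 0" "\<sigma>\<^sup>2 = 1 / c" using assms by (simp_all add: \<sigma>_def power_divide)
  have "exp (- (1 / 2) * (c * (t - s)\<^sup>2)) = sqrt (2 * pi / c) * normal_density s \<sigma> t" for t
    using assms by (simp add: normal_density_def \<sigma>(2) mult.commute)
  then have "(\<integral>\<^sup>+t. ennreal (exp (- (1 / 2) * (c * (t - s)\<^sup>2))) \<partial>lborel)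
      = (\<integral>\<^sup>+t. ennreal (sqrt (2 * pi / c)) * ennreal (normal_density s \<sigma> t) \<partial>lborel)"
    using assms by (simp add: ennreal_mult)
  also have "\<dots> = ennreal (sqrt (2 * pi / c)) * (\<integral>\<^sup>+t. ennreal (normal_density s \<sigma> t) \<partial>lborel)"
    by (rule nn_integral_cmult) simp
  also have "(\<integral>\<^sup>+t. ennreal (normal_density s \<sigma> t) \<partial>lborel) = 1"
    using \<sigma>(1) by (subst nn_integral_eq_integral) auto
  finally show ?thesis by simp
qed

text \<open>Integrating out the last coordinate leaves the same kind of integral for the Schur
  complement, and both sides pick up the factor \<open>sqrt (2 * pi / c)\<close>. Nonnegative
  integrals allow coordinates to be separated without first proving integrability.\<close>

lemma nn_integral_exp_quadratic:
  assumes "sym_pos_def_mat n A"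
  shows "(\<integral>\<^sup>+y. ennreal (exp (- (1 / 2) * (\<Sum>i<n. \<Sum>j<n. A $$ (i, j) * (y i - \<mu> i) * (y j - \<mu> j))))
      \<partial>(\<Pi>\<^sub>M i\<in>{..<n}. (lborel :: real measure))) = ennreal (sqrt ((2 * pi) ^ n / Determinant.det A))"
  using assms
proof (induction n arbitrary: A)
  case 0
  then have "Determinant.det A = 1" by (simp add: sym_pos_def_mat_def)
  \<comment> \<open>In dimension 0 the product measure is a unit mass at one point and the integrand
    there is 1.\<close>
  then show ?case by (simp add: PiM_empty nn_integral_count_space_finite)
next
  case (Suc n)
  interpret product_sigma_finite "\<lambda>_ :: nat. lborel :: real measure" ..
  define C where "C = schur_complement n A"
  define c where "c = A $$ (n, n)"
  define q where "q y = (\<Sum>i<n. \<Sum>j<n. C $$ (i, j) * (y i - \<mu> i) * (y j - \<mu> j))" for y :: "nat \<Rightarrow> real"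
  have C: "sym_pos_def_mat n C"
    unfolding C_def by (rule sym_pos_def_mat_schur_complement[OF Suc.prems])
  have c: "c > 0" unfolding c_def by (rule sym_pos_def_mat_diag_pos[OF Suc.prems]) simp
  have detC: "Determinant.det C > 0" by (rule sym_pos_def_mat_det_pos[OF C])
  have detA: "Determinant.det A = Determinant.det C * c"
    using Suc.prems c unfolding C_def c_def
    by (intro det_schur_complement) (auto simp: sym_pos_def_mat_def)
  \<comment> \<open>The centre of the square in \<open>t\<close> depends on \<open>y\<close>, but
    the integral over \<open>t\<close> does not depend on the centre.\<close>
  have split: "(\<Sum>i<Suc n. \<Sum>j<Suc n. A $$ (i, j) * ((y(n := t)) i - \<mu> i) * ((y(n := t)) j - \<mu> j)) =
      q y + c * (t - (\<mu> n - (\<Sum>j<n. A $$ (n, j) * (y j - \<mu> j)) / c))\<^sup>2" for y t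
  proof -
    have [simp]: "t - (\<mu> n - u) = t - \<mu> n + u" for u by simp
    have "A $$ (i, n) = A $$ (n, i)" if "i < n" for i
      using that by (intro sym_pos_def_mat_index_sym[OF Suc.prems]) simp_all
    moreover have "A $$ (n, n) \<noteq> 0" using c by (simp add: c_def)
    ultimately show ?thesis
      using sum_eq_schur_complement[of n A "\<lambda>i. (y(n := t)) i - \<mu> i"]
      unfolding c_def q_def C_def by (simp del: sum.lessThan_Suc)
  qed
  \<comment> \<open>The index set is written as \<open>insert n {..<n}\<close> so that coordinate
    \<open>n\<close> splits off as the inner integral.\<close>
  have "(\<integral>\<^sup>+y. ennreal (exp (- (1 / 2) * (\<Sum>i<Suc n. \<Sum>j<Suc n. A $$ (i, j) * (y i - \<mu> i) * (y j - \<mu> j))))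
        \<partial>(\<Pi>\<^sub>M i\<in>insert n {..<n}. (lborel :: real measure)))
      = (\<integral>\<^sup>+y. \<integral>\<^sup>+t. ennreal (exp (- (1 / 2) *
          (\<Sum>i<Suc n. \<Sum>j<Suc n. A $$ (i, j) * ((y(n := t)) i - \<mu> i) * ((y(n := t)) j - \<mu> j))))
        \<partial>lborel \<partial>(\<Pi>\<^sub>M i\<in>{..<n}. lborel))"
    by (subst product_nn_integral_insert) (auto simp del: sum.lessThan_Suc simp: lessThan_Suc[symmetric])
  also have "\<dots> = (\<integral>\<^sup>+y. ennreal (exp (- (1 / 2) * q y)) * ennreal (sqrt (2 * pi / c)) \<partial>(\<Pi>\<^sub>M i\<in>{..<n}. lborel))"
  proof (rule nn_integral_cong)
    fix y :: "nat \<Rightarrow> real"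
    define s where "s = \<mu> n - (\<Sum>j<n. A $$ (n, j) * (y j - \<mu> j)) / c"
    have "(\<integral>\<^sup>+t. ennreal (exp (- (1 / 2) * (q y + c * (t - s)\<^sup>2))) \<partial>lborel)
        = (\<integral>\<^sup>+t. ennreal (exp (- (1 / 2) * q y)) * ennreal (exp (- (1 / 2) * (c * (t - s)\<^sup>2))) \<partial>lborel)"
      by (simp add: ennreal_mult[symmetric] exp_add[symmetric] algebra_simps)
    also have "\<dots> = ennreal (exp (- (1 / 2) * q y)) * ennreal (sqrt (2 * pi / c))"
      by (subst nn_integral_cmult) (simp_all only: nn_integral_exp_neg_square[OF c], measurable)
    finally show "(\<integral>\<^sup>+t. ennreal (exp (- (1 / 2) *
          (\<Sum>i<Suc n. \<Sum>j<Suc n. A $$ (i, j) * ((y(n := t)) i - \<mu> i) * ((y(n := t)) j - \<mu> j)))) \<partial>lborel)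
        = ennreal (exp (- (1 / 2) * q y)) * ennreal (sqrt (2 * pi / c))"
      unfolding split s_def .
  qed
  also have "\<dots> = ennreal (sqrt ((2 * pi) ^ n / Determinant.det C)) * ennreal (sqrt (2 * pi / c))"
    \<comment> \<open>The induction hypothesis is used from right to left: its value becomes an
      integral again, into which the constant factor moves.\<close>
    unfolding Suc.IH[OF C, folded q_def, symmetric]
    by (rule nn_integral_multc) (unfold q_def, measurable)
  also have "\<dots> = ennreal (sqrt ((2 * pi) ^ Suc n / Determinant.det A))"
    using c detC by (simp add: ennreal_mult[symmetric] real_sqrt_mult[symmetric] detA mult.commute)
  finally show ?case by (simp only: lessThan_Suc)
qed

section \<open>Symmetric positive definite matrices and Gaussian densities\<close>

lemma mat_inv_inverts:
  assumes A: "A \<in> carrier_mat n n" and det: "Determinant.det A \<noteq> 0"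
  shows "mat_inv A \<in> carrier_mat n n" "A * mat_inv A = 1\<^sub>m n" "mat_inv A * A = 1\<^sub>m n"
proof -
  \<comment> \<open>A nonzero determinant makes \<open>A\<close> a unit of the matrix ring, so
    \<open>mat_inverse\<close> returns \<open>Some\<close> and \<open>the\<close> is
    harmless.\<close>
  have "A \<in> Units (ring_mat TYPE(real) n ())" by (rule det_non_zero_imp_unit[OF A det])
  then obtain B where B: "mat_inverse A = Some B" using mat_inverse(1)[OF A, of "()"] by blast
  show "mat_inv A \<in> carrier_mat n n" "A * mat_inv A = 1\<^sub>m n" "mat_inv A * A = 1\<^sub>m n"
    using mat_inverse(2)[OF A B] by (simp_all add: mat_inv_def B)
qed

text \<open>A one-sided inverse suffices for square matrices: multiplicativity of the determinant
  already forces \<open>A\<close> to be invertible.\<close>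

lemma mat_inv_eqI:
  assumes A: "A \<in> carrier_mat n n" and B: "B \<in> carrier_mat n n" and AB: "A * B = 1\<^sub>m n"
  shows "mat_inv A = B"
proof -
  have "Determinant.det A * Determinant.det B = 1" using det_mult[OF A B] AB by simp
  then have "Determinant.det A \<noteq> 0" by auto
  note inv = mat_inv_inverts[OF A this]
  have "mat_inv A = mat_inv A * (A * B)" using inv by (simp add: AB)
  also have "\<dots> = (mat_inv A * A) * B" using assoc_mult_mat[OF inv(1) A B] by simp
  also have "\<dots> = B" using inv B by simp
  finally show ?thesis .
qed

lemma sym_pos_def_mat_carrier: "sym_pos_def_mat n A \<Longrightarrow> A \<in> carrier_mat n n"
  by (simp add: sym_pos_def_mat_def)

lemma sym_pos_def_mat_transpose: "sym_pos_def_mat n A \<Longrightarrow> transpose_mat A = A"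
  by (simp add: sym_pos_def_mat_def)

lemma sym_pos_def_mat_inv_inverts:
  assumes "sym_pos_def_mat n A"
  shows "mat_inv A \<in> carrier_mat n n" "A * mat_inv A = 1\<^sub>m n" "mat_inv A * A = 1\<^sub>m n"
  using mat_inv_inverts[of A n] sym_pos_def_mat_det_pos[OF assms] sym_pos_def_mat_carrier[OF assms]
  by auto

lemma sym_pos_def_mat_nonneg:
  "sym_pos_def_mat n A \<Longrightarrow> v \<in> carrier_vec n \<Longrightarrow> 0 \<le> scalar_prod v (A *\<^sub>v v)"
  by (cases "v = 0\<^sub>v n") (auto simp: sym_pos_def_mat_def intro: less_imp_le)

lemma sym_pos_def_mat_inv:
  assumes A: "sym_pos_def_mat n A"
  shows "sym_pos_def_mat n (mat_inv A)"
  unfolding sym_pos_def_mat_def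
proof (intro conjI ballI impI)
  note inv = sym_pos_def_mat_inv_inverts[OF A]
  note cA = sym_pos_def_mat_carrier[OF A]
  show "mat_inv A \<in> carrier_mat n n" by (rule inv)
  \<comment> \<open>Transposing shows that the transposed inverse is again a right inverse of
    \<open>A\<close>; uniqueness gives symmetry.\<close>
  have "transpose_mat (mat_inv A * A) = 1\<^sub>m n" using inv by simp
  then have "A * transpose_mat (mat_inv A) = 1\<^sub>m n"
    using transpose_mult[OF inv(1) cA] sym_pos_def_mat_transpose[OF A] by simp
  then show "transpose_mat (mat_inv A) = mat_inv A"
    using mat_inv_eqI[OF cA, of "transpose_mat (mat_inv A)"] inv by simp
  fix v :: "real Matrix.vec" assume v: "v \<in> carrier_vec n" "v \<noteq> 0\<^sub>v n"
  \<comment> \<open>With \<open>v = A w\<close> the form of the inverse at \<open>v\<close> becomes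
    the form of \<open>A\<close> at \<open>w\<close>.\<close>
  define w where "w = mat_inv A *\<^sub>v v"
  have w: "w \<in> carrier_vec n" using inv v by (simp add: w_def)
  have Aw: "A *\<^sub>v w = v"
    unfolding w_def using assoc_mult_mat_vec[OF cA inv(1) v(1)] inv v by simp
  have "w \<noteq> 0\<^sub>v n" using Aw v cA by auto
  then have "0 < scalar_prod w (A *\<^sub>v w)" using A w by (auto simp: sym_pos_def_mat_def)
  also have "\<dots> = scalar_prod v (mat_inv A *\<^sub>v v)"
    unfolding Aw using comm_scalar_prod[OF w v(1)] by (simp add: w_def)
  finally show "0 < scalar_prod v (mat_inv A *\<^sub>v v)" .
qed

text \<open>Serves both for the innovation covariance, with \<open>B\<close> the transpose of
  \<open>H\<close>, and for the posterior precision, with \<open>B = H\<close>. The congruence term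
  may vanish on the kernel of \<open>B\<close>, so strict positivity comes from
  \<open>C\<close>.\<close>

lemma sym_pos_def_mat_congruence_add:
  assumes A: "sym_pos_def_mat n A" and B: "B \<in> carrier_mat n m" and C: "sym_pos_def_mat m C"
  shows "sym_pos_def_mat m (transpose_mat B * A * B + C)"
  unfolding sym_pos_def_mat_def
proof (intro conjI ballI impI)
  note cA = sym_pos_def_mat_carrier[OF A] and cC = sym_pos_def_mat_carrier[OF C]
  have Bt: "transpose_mat B \<in> carrier_mat m n" using B by simp
  have BtA: "transpose_mat B * A \<in> carrier_mat m n" using Bt cA by simp
  have BtAB: "transpose_mat B * A * B \<in> carrier_mat m m" using BtA B by simp
  show "transpose_mat B * A * B + C \<in> carrier_mat m m" using cC by simp
  have "transpose_mat (transpose_mat B * A * B) = transpose_mat B * (transpose_mat A * B)"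
    using transpose_mult[OF BtA B] transpose_mult[OF Bt cA] by simp
  also have "\<dots> = transpose_mat B * A * B"
    using assoc_mult_mat[OF Bt cA B] sym_pos_def_mat_transpose[OF A] by simp
  finally show "transpose_mat (transpose_mat B * A * B + C) = transpose_mat B * A * B + C"
    using transpose_add[OF BtAB cC] sym_pos_def_mat_transpose[OF C] by simp
  fix v :: "real Matrix.vec" assume v: "v \<in> carrier_vec m" "v \<noteq> 0\<^sub>v m"
  have Bv: "B *\<^sub>v v \<in> carrier_vec n" using B v by simp
  have "scalar_prod v ((transpose_mat B * A * B + C) *\<^sub>v v)
      = scalar_prod v (transpose_mat B *\<^sub>v (A *\<^sub>v (B *\<^sub>v v)) + C *\<^sub>v v)"
    using add_mult_distrib_mat_vec[OF BtAB cC v(1)] assoc_mult_mat_vec[OF BtA B v(1)]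
      assoc_mult_mat_vec[OF Bt cA Bv] by simp
  also have "\<dots> = scalar_prod v (transpose_mat B *\<^sub>v (A *\<^sub>v (B *\<^sub>v v))) + scalar_prod v (C *\<^sub>v v)"
    by (rule scalar_prod_add_distrib[where n = m]) (use v Bt cA cC Bv in auto)
  also have "scalar_prod v (transpose_mat B *\<^sub>v (A *\<^sub>v (B *\<^sub>v v))) = scalar_prod (B *\<^sub>v v) (A *\<^sub>v (B *\<^sub>v v))"
    using transpose_vec_mult_scalar[OF Bt, of "A *\<^sub>v (B *\<^sub>v v)" v] v cA Bv by simp
  finally show "0 < scalar_prod v ((transpose_mat B * A * B + C) *\<^sub>v v)"
    using sym_pos_def_mat_nonneg[OF A Bv] C v unfolding sym_pos_def_mat_def by fastforce
qed

text \<open>Sylvester's identity. Multiplying \<open>M\<close> by the unit triangular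
  \<open>U\<close> on the right or on the left clears the upper right block and leaves one of the
  two matrices on the diagonal; both products have the determinant of \<open>M\<close>.\<close>

lemma det_one_plus_mult_commute:
  fixes A B :: "'a :: idom mat"
  assumes A: "A \<in> carrier_mat m n" and B: "B \<in> carrier_mat n m"
  shows "Determinant.det (1\<^sub>m m + A * B) = Determinant.det (1\<^sub>m n + B * A)"
proof -
  define M where "M = four_block_mat (1\<^sub>m m) (- A) B (1\<^sub>m n)"
  define U where "U = four_block_mat (1\<^sub>m m) A (0\<^sub>m n m) (1\<^sub>m n)"
  have car: "M \<in> carrier_mat (m + n) (m + n)" "U \<in> carrier_mat (m + n) (m + n)"
    unfolding M_def U_def by (rule four_block_carrier_mat; simp)+
  have detU: "Determinant.det U = 1"
    unfolding U_def using A by (subst det_four_block_mat_lower_left_zero[of _ m _ n]) auto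
  have mA: "- A \<in> carrier_mat m n" using A by simp
  have "M * U = four_block_mat (1\<^sub>m m) (0\<^sub>m m n) B (1\<^sub>m n + B * A)"
    unfolding M_def U_def
    by (subst mult_four_block_mat[of _ m m _ n _ n _ _ m _ n])
      (use A B mA in \<open>auto intro!: cong_four_block_mat simp: uminus_l_inv_mat comm_add_mat[of _ n n]\<close>)
  then have "Determinant.det (M * U) = Determinant.det (1\<^sub>m n + B * A)"
    using A B by (auto simp: det_four_block_mat_upper_right_zero[of _ m _ n])
  moreover have "U * M = four_block_mat (1\<^sub>m m + A * B) (0\<^sub>m m n) B (1\<^sub>m n)"
    unfolding M_def U_def
    by (subst mult_four_block_mat[of _ m m _ n _ n _ _ m _ n])
      (use A B mA in \<open>auto intro!: cong_four_block_mat simp: uminus_l_inv_mat comm_add_mat[of _ n n]\<close>)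
  then have "Determinant.det (U * M) = Determinant.det (1\<^sub>m m + A * B)"
    using A B by (auto simp: det_four_block_mat_upper_right_zero[of _ m _ n])
  ultimately show ?thesis using det_mult[OF car] det_mult[OF car(2,1)] detU by simp
qed

section \<open>Measurability and normalization of the Gaussian density\<close>

lemma gaussian_vec_eq:
  assumes P: "sym_pos_def_mat n P" and \<mu>: "\<mu> \<in> carrier_vec n"
  shows "gaussian (Matrix.vec n y) \<mu> P = exp (- (1 / 2) * (\<Sum>i<n. \<Sum>j<n.
    mat_inv P $$ (i, j) * (y i - vec_index \<mu> i) * (y j - vec_index \<mu> j))) /
    sqrt ((2 * pi) ^ n * Determinant.det P)"
proof -
  have "Matrix.vec n y - \<mu> \<in> carrier_vec n" using \<mu> by simp
  then show ?thesis
    using \<mu> sym_pos_def_mat_carrier[OF P] unfolding gaussian_def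
    by (subst scalar_prod_mult_mat_vec_eq_sum[OF sym_pos_def_mat_inv_inverts(1)[OF P]]) auto
qed

lemma borel_measurable_gaussian:
  assumes P: "sym_pos_def_mat n P" and \<mu>: "\<mu> \<in> carrier_vec n"
  shows "(\<lambda>x. gaussian x \<mu> P) \<in> borel_measurable (lborel_vec n)"
  unfolding lborel_vec_def
  \<comment> \<open>On the embedded measure it suffices that the composition with
    \<open>Matrix.vec n\<close> is measurable, which the coordinate form makes explicit.\<close>
  by (rule measurable_embed_measure1) (unfold gaussian_vec_eq[OF assms], measurable)

lemma gaussian_pos: "sym_pos_def_mat n P \<Longrightarrow> gaussian x \<mu> P > 0"
  using sym_pos_def_mat_det_pos[of n P] by (auto simp: gaussian_def)

lemma integrable_integral_gaussian:
  assumes P: "sym_pos_def_mat n P" and \<mu>: "\<mu> \<in> carrier_vec n"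
  shows "integrable (lborel_vec n) (\<lambda>x. gaussian x \<mu> P)" "(LINT x|lborel_vec n. gaussian x \<mu> P) = 1"
proof -
  let ?M = "\<Pi>\<^sub>M i\<in>{..<n}. (lborel :: real measure)"
  define k where "k = sqrt ((2 * pi) ^ n * Determinant.det P)"
  define q where "q y = (\<Sum>i<n. \<Sum>j<n.
    mat_inv P $$ (i, j) * (y i - vec_index \<mu> i) * (y j - vec_index \<mu> j))" for y
  have detP: "Determinant.det P > 0" by (rule sym_pos_def_mat_det_pos[OF P])
  then have k: "k > 0" by (simp add: k_def)
  have "Determinant.det P * Determinant.det (mat_inv P) = 1"
    using det_mult[OF sym_pos_def_mat_carrier[OF P] sym_pos_def_mat_inv_inverts(1)[OF P]]
    by (simp add: sym_pos_def_mat_inv_inverts[OF P])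
  then have det: "Determinant.det (mat_inv P) = 1 / Determinant.det P"
    using detP by (simp add: field_simps)
  have "(\<integral>\<^sup>+x. ennreal (gaussian x \<mu> P) \<partial>lborel_vec n) = (\<integral>\<^sup>+y. ennreal (gaussian (Matrix.vec n y) \<mu> P) \<partial>?M)"
    using borel_measurable_gaussian[OF assms] unfolding lborel_vec_def
    by (intro nn_integral_embed_measure' inj_on_vec_PiM) simp
  also have "\<dots> = (\<integral>\<^sup>+y. ennreal (exp (- (1 / 2) * q y)) * ennreal (1 / k) \<partial>?M)"
    using k unfolding gaussian_vec_eq[OF assms] k_def[symmetric] q_def[symmetric]
    by (simp add: ennreal_mult[symmetric])
  also have "\<dots> = (\<integral>\<^sup>+y. ennreal (exp (- (1 / 2) * q y)) \<partial>?M) * ennreal (1 / k)"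
    by (rule nn_integral_multc) (unfold q_def, measurable)
  \<comment> \<open>The exponent carries the inverse of \<open>P\<close>, whose determinant is
    \<open>1 / det P\<close>; hence the value of the integral is the normalizing constant
    \<open>k\<close> itself.\<close>
  also have "\<dots> = ennreal k * ennreal (1 / k)"
    unfolding q_def nn_integral_exp_quadratic[OF sym_pos_def_mat_inv[OF P]] by (simp add: det k_def)
  also have "\<dots> = ennreal 1" using k by (simp add: ennreal_mult[symmetric])
  finally have "(\<integral>\<^sup>+x. ennreal (gaussian x \<mu> P) \<partial>lborel_vec n) = ennreal 1" .
  then have "integrable (lborel_vec n) (\<lambda>x. gaussian x \<mu> P) \<and> (LINT x|lborel_vec n. gaussian x \<mu> P) = 1"
    using borel_measurable_gaussian[OF assms] gaussian_pos[OF P, THEN less_imp_le]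
    by (subst (asm) nn_integral_eq_integrable) auto
  then show "integrable (lborel_vec n) (\<lambda>x. gaussian x \<mu> P)" "(LINT x|lborel_vec n. gaussian x \<mu> P) = 1"
    by auto
qed

section \<open>Conditioning in a linear Gaussian model\<close>

text \<open>
  Variants of library laws whose premises contain no dimensions that are absent from the
  conclusion, so that they work as conditional rewrite rules.
\<close>

lemma mat_mult_assoc_dim:
  fixes A B C :: "'a :: semiring_0 mat"
  shows "dim_col A = dim_row B \<Longrightarrow> dim_col B = dim_row C \<Longrightarrow> A * B * C = A * (B * C)"
  by (rule assoc_mult_mat[of A "dim_row A" "dim_col A" B "dim_col B" C "dim_col C"]) auto

lemma mat_mult_vec_assoc_dim:
  fixes A B :: "'a :: semiring_0 mat"
  shows "dim_col A = dim_row B \<Longrightarrow> dim_col B = dim_vec v \<Longrightarrow> (A * B) *\<^sub>v v = A *\<^sub>v (B *\<^sub>v v)"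
  by (rule assoc_mult_mat_vec[of A "dim_row A" "dim_col A" B "dim_col B"]) auto

lemma mat_add_mult_distrib_dim:
  fixes A B C :: "'a :: semiring_0 mat"
  shows "dim_row A = dim_row B \<Longrightarrow> dim_col A = dim_col B \<Longrightarrow> dim_col B = dim_row C \<Longrightarrow> (A + B) * C = A * C + B * C"
  by (rule add_mult_distrib_mat[of A "dim_row A" "dim_col A" B C "dim_col C"]) auto

lemma mat_mult_add_distrib_dim:
  fixes A B C :: "'a :: semiring_0 mat"
  shows "dim_row B = dim_row C \<Longrightarrow> dim_col B = dim_col C \<Longrightarrow> dim_col A = dim_row C \<Longrightarrow> A * (B + C) = A * B + A * C"
  by (rule mult_add_distrib_mat[of A "dim_row A" "dim_col A" B "dim_col B" C]) auto

text \<open>In the mixed terms the inverse cancels against \<open>A\<close>, leaving the plain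
  scalar product of \<open>u\<close> and \<open>b\<close>. The scalar \<open>k\<close> is 1 for the
  prior and -1 for the likelihood, which gives the mixed terms opposite signs.\<close>

lemma sym_pos_def_quadratic_inverse:
  assumes A: "sym_pos_def_mat n A" and u: "u \<in> carrier_vec n" and b: "b \<in> carrier_vec n"
  shows "scalar_prod (A *\<^sub>v u + k \<cdot>\<^sub>v b) (mat_inv A *\<^sub>v (A *\<^sub>v u + k \<cdot>\<^sub>v b)) =
    scalar_prod u (A *\<^sub>v u) + 2 * k * scalar_prod u b + k\<^sup>2 * scalar_prod b (mat_inv A *\<^sub>v b)"
proof -
  note inv = sym_pos_def_mat_inv_inverts[OF A]
  note cA = sym_pos_def_mat_carrier[OF A]
  have car: "A *\<^sub>v u \<in> carrier_vec n" "mat_inv A *\<^sub>v b \<in> carrier_vec n" "k \<cdot>\<^sub>v b \<in> carrier_vec n"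
    using cA u b inv by auto
  have "mat_inv A *\<^sub>v (A *\<^sub>v u + k \<cdot>\<^sub>v b) = u + k \<cdot>\<^sub>v (mat_inv A *\<^sub>v b)"
    using mult_add_distrib_mat_vec[OF inv(1) car(1,3)] assoc_mult_mat_vec[OF inv(1) cA u]
      mult_mat_vec[OF inv(1) b] inv u by simp
  moreover have "scalar_prod (A *\<^sub>v u) (mat_inv A *\<^sub>v b) = scalar_prod u b"
    using transpose_vec_mult_scalar[OF cA car(2) u] sym_pos_def_mat_transpose[OF A]
      assoc_mult_mat_vec[OF cA inv(1) b] inv b by simp
  moreover have "scalar_prod (A *\<^sub>v u) u = scalar_prod u (A *\<^sub>v u)" "scalar_prod b u = scalar_prod u b"
    using comm_scalar_prod car u b by blast+
  ultimately show ?thesis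
    using car u b
    by (simp add: add_scalar_prod_distrib[of _ n] scalar_prod_add_distrib[of _ n] power2_eq_square algebra_simps)
qed

section \<open>The Kalman update for a single mode\<close>

locale linear_gaussian_model =
  fixes n nz :: nat and P H R :: "real mat"
  assumes P: "sym_pos_def_mat n P" and H: "H \<in> carrier_mat nz n" and R: "sym_pos_def_mat nz R"
begin

abbreviation "HT \<equiv> transpose_mat H"
abbreviation "innovation_cov \<equiv> H * P * HT + R"
abbreviation "gain \<equiv> P * HT * mat_inv innovation_cov"
abbreviation "posterior_cov \<equiv> P - gain * H * P"
abbreviation "information \<equiv> HT * mat_inv R * H + mat_inv P"

lemma innovation_cov: "sym_pos_def_mat nz innovation_cov"
  using sym_pos_def_mat_congruence_add[OF P _ R, of HT] H by simp

lemma information: "sym_pos_def_mat n information"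
  by (rule sym_pos_def_mat_congruence_add[OF sym_pos_def_mat_inv[OF R] H sym_pos_def_mat_inv[OF P]])

lemma carriers:
  "P \<in> carrier_mat n n" "R \<in> carrier_mat nz nz" "mat_inv P \<in> carrier_mat n n"
  "mat_inv R \<in> carrier_mat nz nz" "mat_inv innovation_cov \<in> carrier_mat nz nz"
  using P R innovation_cov by (auto simp: sym_pos_def_mat_inv_inverts sym_pos_def_mat_carrier)

lemma dims [simp]:
  "dim_row P = n" "dim_col P = n" "dim_row H = nz" "dim_col H = n" "dim_row R = nz" "dim_col R = nz"
  "dim_row (mat_inv P) = n" "dim_col (mat_inv P) = n"
  "dim_row (mat_inv R) = nz" "dim_col (mat_inv R) = nz"
  "dim_row (mat_inv innovation_cov) = nz" "dim_col (mat_inv innovation_cov) = nz"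
  using carriers H by auto

lemma mat_inv_mult_cancel:
  assumes "X \<in> carrier_mat n k"
  shows "mat_inv P * (P * X) = X"
  using assms sym_pos_def_mat_inv_inverts[OF P] by (simp flip: mat_mult_assoc_dim)

lemma posterior_cov_carrier: "posterior_cov \<in> carrier_mat n n"
  by auto

text \<open>The matrix inversion lemma, linking the covariance form of the update to its information
  form. Both \<open>information * P - 1\<close> and the product of \<open>information\<close> with
  the correction term reduce to the same matrix \<open>?Z\<close>.\<close>

lemma information_mult_posterior_cov: "information * posterior_cov = 1\<^sub>m n"
proof -
  let ?S = innovation_cov
  let ?Z = "HT * (mat_inv R * (H * P))"
  note mat_dim = mat_mult_assoc_dim mat_add_mult_distrib_dim mat_mult_add_distrib_dim
  note invP = sym_pos_def_mat_inv_inverts[OF P] and invR = sym_pos_def_mat_inv_inverts[OF R]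
  have HT: "HT \<in> carrier_mat n nz" using H by simp
  have Z: "?Z \<in> carrier_mat n n" by auto
  have QP: "information * P = ?Z + 1\<^sub>m n"
    by (simp add: mat_dim invP)
  \<comment> \<open>The factor \<open>?S\<close> produced here on the right cancels the inverse
    contained in the gain.\<close>
  have "information * (P * HT) = HT * (mat_inv R * (H * (P * HT))) + HT"
    by (simp add: mat_dim mat_inv_mult_cancel[OF HT])
  also have "\<dots> = HT * (mat_inv R * ?S)"
    using right_mult_one_mat[OF HT] by (simp add: mat_dim invR)
  finally have QPH: "information * (P * HT) = HT * (mat_inv R * ?S)" .
  have "information * (gain * H * P) = information * (P * HT) * (mat_inv ?S * (H * P))"
  proof -
    \<comment> \<open>The inverse of \<open>?S\<close> is replaced by a variable so that
      reassociation cannot rewrite the products inside it.\<close>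
    have "information * (P * HT * X * H * P) = information * (P * HT) * (X * (H * P))"
      if "X \<in> carrier_mat nz nz" for X
      using that by (simp add: mat_mult_assoc_dim)
    then show ?thesis using carriers by blast
  qed
  also have "\<dots> = HT * (mat_inv R * ((?S * mat_inv ?S) * (H * P)))"
  proof -
    have "HT * (mat_inv R * X) * (Y * (H * P)) = HT * (mat_inv R * ((X * Y) * (H * P)))"
      if "X \<in> carrier_mat nz nz" "Y \<in> carrier_mat nz nz" for X Y
      using that by (simp add: mat_mult_assoc_dim)
    then show ?thesis
      unfolding QPH using carriers(5) sym_pos_def_mat_carrier[OF innovation_cov] by blast
  qed
  also have "\<dots> = ?Z"
    using sym_pos_def_mat_inv_inverts[OF innovation_cov] left_mult_one_mat[of "H * P" nz n]
    by (simp add: carrier_matI)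
  finally have QK: "information * (gain * H * P) = ?Z" .
  have "information * posterior_cov = information * P - information * (gain * H * P)"
    by (rule mult_minus_distrib_mat[OF sym_pos_def_mat_carrier[OF information] carriers(1)])
      (auto intro: carrier_matI)
  also have "\<dots> = 1\<^sub>m n"
  proof -
    have "X + 1\<^sub>m n - X = 1\<^sub>m n" if "X \<in> carrier_mat n n" for X :: "real mat"
      using that by (intro eq_matI) auto
    then show ?thesis unfolding QP QK using Z by blast
  qed
  finally show ?thesis .
qed

lemma mat_inv_information: "mat_inv information = posterior_cov"
  by (rule mat_inv_eqI[OF sym_pos_def_mat_carrier[OF information] posterior_cov_carrier
        information_mult_posterior_cov])

text \<open>Positivity is not visible in the difference; it is inherited from
  \<open>information\<close>, whose inverse this matrix is.\<close>

lemma posterior_cov: "sym_pos_def_mat n posterior_cov"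
  using sym_pos_def_mat_inv[OF information] by (simp only: mat_inv_information)

lemma mat_inv_posterior_cov: "mat_inv posterior_cov = information"
  using sym_pos_def_mat_inv_inverts[OF information]
  by (intro mat_inv_eqI[OF posterior_cov_carrier sym_pos_def_mat_carrier[OF information]])
    (simp only: mat_inv_information)

text \<open>Factoring \<open>R\<close> out of the innovation covariance and applying Sylvester's
  identity turns the other factor into \<open>det (P * information)\<close>; the determinant of
  \<open>information\<close> then cancels against that of its inverse.\<close>

lemma det_innovation_cov_mult_posterior_cov:
  "Determinant.det innovation_cov * Determinant.det posterior_cov = Determinant.det R * Determinant.det P"
proof -
  note mat_dim = mat_mult_assoc_dim mat_add_mult_distrib_dim mat_mult_add_distrib_dim
  have A: "mat_inv R * H \<in> carrier_mat nz n" and B: "P * HT \<in> carrier_mat n nz"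
    by auto
  have "R * (1\<^sub>m nz + (mat_inv R * H) * (P * HT)) = R * 1\<^sub>m nz + (R * mat_inv R) * (H * (P * HT))"
    by (simp add: mat_dim)
  also have "\<dots> = innovation_cov"
    using left_mult_one_mat[of "H * (P * HT)" nz nz] comm_add_mat[of R nz nz "H * (P * HT)"]
    by (simp add: sym_pos_def_mat_inv_inverts[OF R] carrier_matI mat_mult_assoc_dim carriers)
  finally have S: "R * (1\<^sub>m nz + (mat_inv R * H) * (P * HT)) = innovation_cov" .
  have "1\<^sub>m n + (P * HT) * (mat_inv R * H) = P * information"
    using comm_add_mat[of "1\<^sub>m n" n n "P * (HT * (mat_inv R * H))"]
    by (simp add: mat_dim sym_pos_def_mat_inv_inverts[OF P] carrier_matI)
  then have "Determinant.det innovation_cov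
      = Determinant.det R * (Determinant.det P * Determinant.det information)"
    unfolding S[symmetric] using det_one_plus_mult_commute[OF A B]
      det_mult[OF carriers(1) sym_pos_def_mat_carrier[OF information]]
    by (subst det_mult[OF carriers(2)]) (auto intro!: carrier_matI)
  moreover have "Determinant.det information * Determinant.det posterior_cov = 1"
    using det_mult[OF sym_pos_def_mat_carrier[OF information] posterior_cov_carrier]
    by (simp only: information_mult_posterior_cov det_one)
  ultimately show ?thesis by (simp only: mult.assoc mult_1_right)
qed

lemma exponent_identity:
  assumes e: "e \<in> carrier_vec n" and v: "v \<in> carrier_vec nz"
  shows "scalar_prod (v - H *\<^sub>v e) (mat_inv R *\<^sub>v (v - H *\<^sub>v e)) + scalar_prod e (mat_inv P *\<^sub>v e)
    = scalar_prod v (mat_inv innovation_cov *\<^sub>v v)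
      + scalar_prod (e - gain *\<^sub>v v) (information *\<^sub>v (e - gain *\<^sub>v v))"
proof -
  let ?S = innovation_cov
  \<comment> \<open>With these abbreviations the gain term is \<open>P g\<close>, and
    \<open>h\<close> is what remains of \<open>H e\<close> once \<open>H (P g)\<close> is
    removed.\<close>
  define s where "s = mat_inv ?S *\<^sub>v v"
  define g where "g = HT *\<^sub>v s"
  define w where "w = e - gain *\<^sub>v v"
  define h where "h = H *\<^sub>v w"
  note invS = sym_pos_def_mat_inv_inverts[OF innovation_cov]
  have s: "s \<in> carrier_vec nz" and g: "g \<in> carrier_vec n" and w: "w \<in> carrier_vec n" and h: "h \<in> carrier_vec nz"
    using e v H carriers by (auto simp: s_def g_def w_def h_def intro!: carrier_vecI)
  have Pg: "P *\<^sub>v g \<in> carrier_vec n" and Rs: "R *\<^sub>v s \<in> carrier_vec nz"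
    using carriers g s by auto
  have "gain *\<^sub>v v = P *\<^sub>v g"
    using v by (simp add: g_def s_def mat_mult_vec_assoc_dim)
  \<comment> \<open>The factor 1 matches the shape of
    \<open>sym_pos_def_quadratic_inverse\<close>.\<close>
  then have e': "e = P *\<^sub>v g + 1 \<cdot>\<^sub>v w"
    using e Pg by (auto simp: w_def)
  have "?S *\<^sub>v s = v"
    using v invS by (simp add: s_def flip: mat_mult_vec_assoc_dim)
  then have v': "v = H *\<^sub>v (P *\<^sub>v g) + R *\<^sub>v s"
    using s add_mult_distrib_mat_vec[of "H * P * HT" nz nz R s] carriers
    by (simp add: g_def mat_mult_vec_assoc_dim carrier_matI)
  have He: "H *\<^sub>v e = H *\<^sub>v (P *\<^sub>v g) + h"
    unfolding e' h_def using mult_add_distrib_mat_vec[OF H Pg w] w by simp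
  have r: "v - H *\<^sub>v e = R *\<^sub>v s + (- 1) \<cdot>\<^sub>v h"
  proof -
    have "a + b - (a + c) = b + (- 1) \<cdot>\<^sub>v c"
      if "a \<in> carrier_vec nz" "b \<in> carrier_vec nz" "c \<in> carrier_vec nz" for a b c :: "real Matrix.vec"
      using that by (intro eq_vecI) auto
    then show ?thesis unfolding He by (subst v') (use h Rs mult_mat_vec_carrier[OF H Pg] in blast)
  qed
  have adj: "scalar_prod g x = scalar_prod s (H *\<^sub>v x)" if "x \<in> carrier_vec n" for x
    using transpose_vec_mult_scalar[OF H that s] by (simp add: g_def)
  have "scalar_prod v s = scalar_prod s v" using comm_scalar_prod v s by blast
  also have "\<dots> = scalar_prod s (H *\<^sub>v (P *\<^sub>v g)) + scalar_prod s (R *\<^sub>v s)"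
    by (subst v', rule scalar_prod_add_distrib[where n = nz]) (use H Pg Rs s in auto)
  also have "\<dots> = scalar_prod g (P *\<^sub>v g) + scalar_prod s (R *\<^sub>v s)"
    using adj[OF Pg] by simp
  \<comment> \<open>The two pure terms in \<open>g\<close> and \<open>s\<close>, one from the prior
    and one from the likelihood, add up to the exponent of the innovation.\<close>
  finally have vs: "scalar_prod v s = scalar_prod g (P *\<^sub>v g) + scalar_prod s (R *\<^sub>v s)" .
  have Rih: "mat_inv R *\<^sub>v h \<in> carrier_vec nz" using carriers h by auto
  have HT: "HT \<in> carrier_mat n nz" using H by simp
  have "information *\<^sub>v w = HT *\<^sub>v (mat_inv R *\<^sub>v h) + mat_inv P *\<^sub>v w"
    using w add_mult_distrib_mat_vec[of "HT * mat_inv R * H" n n "mat_inv P" w] carriers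
    by (simp add: h_def mat_mult_vec_assoc_dim carrier_matI)
  then have "scalar_prod w (information *\<^sub>v w)
      = scalar_prod w (HT *\<^sub>v (mat_inv R *\<^sub>v h)) + scalar_prod w (mat_inv P *\<^sub>v w)"
    using scalar_prod_add_distrib[of w n "HT *\<^sub>v (mat_inv R *\<^sub>v h)" "mat_inv P *\<^sub>v w"] w HT Rih carriers
    by simp
  also have "scalar_prod w (HT *\<^sub>v (mat_inv R *\<^sub>v h)) = scalar_prod h (mat_inv R *\<^sub>v h)"
    using transpose_vec_mult_scalar[OF HT Rih w] by (simp add: h_def)
  finally have "scalar_prod w (information *\<^sub>v w)
      = scalar_prod h (mat_inv R *\<^sub>v h) + scalar_prod w (mat_inv P *\<^sub>v w)" .
  moreover have "scalar_prod e (mat_inv P *\<^sub>v e)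
      = scalar_prod g (P *\<^sub>v g) + 2 * scalar_prod s h + scalar_prod w (mat_inv P *\<^sub>v w)"
    unfolding e' using sym_pos_def_quadratic_inverse[OF P g w, of 1] adj[OF w] by (simp add: h_def)
  moreover have "scalar_prod (v - H *\<^sub>v e) (mat_inv R *\<^sub>v (v - H *\<^sub>v e))
      = scalar_prod s (R *\<^sub>v s) - 2 * scalar_prod s h + scalar_prod h (mat_inv R *\<^sub>v h)"
    unfolding r using sym_pos_def_quadratic_inverse[OF R s h, of "- 1"] by simp
  ultimately show ?thesis using vs by (simp add: w_def[symmetric] s_def[symmetric])
qed

text \<open>The joint density of state and measurement, factored in both orders: likelihood times
  prior equals evidence times posterior.\<close>

lemma gaussian_mult_gaussian:
  assumes x: "x \<in> carrier_vec n" and xp: "xp \<in> carrier_vec n" and d: "d \<in> carrier_vec nz"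
    and z: "z \<in> carrier_vec nz"
  shows "gaussian z (H *\<^sub>v x + d) R * gaussian x xp P =
    gaussian z (H *\<^sub>v xp + d) innovation_cov *
    gaussian x (xp + gain *\<^sub>v (z - (H *\<^sub>v xp + d))) posterior_cov"
proof -
  define v where "v = z - (H *\<^sub>v xp + d)"
  define e where "e = x - xp"
  have v: "v \<in> carrier_vec nz" and e: "e \<in> carrier_vec n"
    using H x xp d z by (auto simp: v_def e_def)
  have He: "H *\<^sub>v e = H *\<^sub>v x - H *\<^sub>v xp"
    unfolding e_def by (rule mult_minus_distrib_mat_vec[OF H x xp])
  have "z - (H *\<^sub>v x + d) = v - H *\<^sub>v e"
  proof -
    have "z - (a + d) = z - (b + d) - (a - b)"
      if "a \<in> carrier_vec nz" "b \<in> carrier_vec nz" for a b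
      using that z d by (intro eq_vecI) auto
    then show ?thesis
      unfolding v_def He using mult_mat_vec_carrier[OF H] x xp by blast
  qed
  moreover have "gain *\<^sub>v v \<in> carrier_vec n" using carriers by (auto intro!: carrier_vecI)
  then have "x - (xp + gain *\<^sub>v v) = e - gain *\<^sub>v v"
    using x xp by (auto simp: e_def)
  moreover have "sqrt ((2 * pi) ^ nz * Determinant.det R) * sqrt ((2 * pi) ^ n * Determinant.det P) =
      sqrt ((2 * pi) ^ nz * Determinant.det innovation_cov) * sqrt ((2 * pi) ^ n * Determinant.det posterior_cov)"
  proof -
    have "((2 * pi) ^ nz * Determinant.det R) * ((2 * pi) ^ n * Determinant.det P)
        = (2 * pi) ^ nz * (2 * pi) ^ n * (Determinant.det R * Determinant.det P)"
      by (simp only: mult_ac)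
    also have "\<dots> = ((2 * pi) ^ nz * Determinant.det innovation_cov) * ((2 * pi) ^ n * Determinant.det posterior_cov)"
      unfolding det_innovation_cov_mult_posterior_cov[symmetric] by (simp only: mult_ac)
    finally show ?thesis by (simp only: real_sqrt_mult[symmetric])
  qed
  moreover have "exp (- (1 / 2) * a) * exp (- (1 / 2) * b) = exp (- (1 / 2) * (a + b))" for a b :: real
    by (simp add: exp_add[symmetric] algebra_simps)
  moreover have "dim_row innovation_cov = nz" "dim_row posterior_cov = n" by simp_all
  ultimately show ?thesis
    unfolding gaussian_def v_def[symmetric] mat_inv_posterior_cov
    by (simp only: times_divide_times_eq exponent_identity[OF e v] e_def[symmetric] dims)
qed

end

section \<open>The hybrid posterior\<close>

theorem theorem4:
  fixes m nz :: nat and n :: "nat \<Rightarrow> nat"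
    and f_pred f_post :: "nat \<Rightarrow> real Matrix.vec \<Rightarrow> real"
    and l :: "real Matrix.vec \<Rightarrow> nat \<Rightarrow> real Matrix.vec \<Rightarrow> real"
    and x_pred x_post d z_hat :: "nat \<Rightarrow> real Matrix.vec"
    and P_pred P_post H R S :: "nat \<Rightarrow> real mat"
    and z :: "real Matrix.vec"
  assumes "m \<ge> 1" and "\<And>r. r \<in> {1..m} \<Longrightarrow> n r \<ge> 1"
    and "\<And>r. r \<in> {1..m} \<Longrightarrow> x_pred r \<in> carrier_vec (n r)"
    and "\<And>r. r \<in> {1..m} \<Longrightarrow> sym_pos_def_mat (n r) (P_pred r)"
    and "\<And>r. r \<in> {1..m} \<Longrightarrow> H r \<in> carrier_mat nz (n r)"
    and "\<And>r. r \<in> {1..m} \<Longrightarrow> d r \<in> carrier_vec nz"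
    and "\<And>r. r \<in> {1..m} \<Longrightarrow> sym_pos_def_mat nz (R r)"
    and "z \<in> carrier_vec nz"
    and predicted: "hybrid_density m n f_pred"
    and predicted_gaussian: "\<And>r x. r \<in> {1..m} \<Longrightarrow> mode_marginal n f_pred r > 0 \<Longrightarrow> x \<in> carrier_vec (n r) \<Longrightarrow>
          f_pred r x = mode_marginal n f_pred r * state_conditional n f_pred r x \<and>
          state_conditional n f_pred r x = gaussian x (x_pred r) (P_pred r)"
    and likelihood: "\<And>y r x. y \<in> carrier_vec nz \<Longrightarrow> r \<in> {1..m} \<Longrightarrow> x \<in> carrier_vec (n r) \<Longrightarrow>
          l y r x = gaussian y (H r *\<^sub>v x + d r) (R r)"
    and posterior: "f_post = bayes_posterior m n (l z) f_pred"
    and z_hat: "\<And>r. r \<in> {1..m} \<Longrightarrow> z_hat r = H r *\<^sub>v x_pred r + d r"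
    and S: "\<And>r. r \<in> {1..m} \<Longrightarrow> S r = H r * P_pred r * transpose_mat (H r) + R r"
    and x_post: "\<And>r. r \<in> {1..m} \<Longrightarrow>
          x_post r = x_pred r + (P_pred r * transpose_mat (H r) * mat_inv (S r)) *\<^sub>v (z - z_hat r)"
    and P_post: "\<And>r. r \<in> {1..m} \<Longrightarrow>
          P_post r = P_pred r - P_pred r * transpose_mat (H r) * mat_inv (S r) * H r * P_pred r"
  shows "hybrid_density m n f_post \<and>
    (\<forall>r\<in>{1..m}. sym_pos_def_mat nz (S r) \<and> sym_pos_def_mat (n r) (P_post r)) \<and>
    (\<forall>r\<in>{1..m}. mode_marginal n f_pred r > 0 \<longrightarrow>
       (\<forall>x\<in>carrier_vec (n r).
          f_post r x = mode_marginal n f_post r * state_conditional n f_post r x \<and>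
          state_conditional n f_post r x = gaussian x (x_post r) (P_post r))) \<and>
    (\<forall>r\<in>{1..m}. mode_marginal n f_post r =
       mode_marginal n f_pred r * gaussian z (z_hat r) (S r) /
       (\<Sum>r'=1..m. mode_marginal n f_pred r' * gaussian z (z_hat r') (S r')))"
proof -
  \<comment> \<open>\<open>c r\<close> is the evidence of mode \<open>r\<close>, \<open>w r\<close>
    its prior probability, and \<open>D\<close> will be the denominator of Bayes' rule.\<close>
  define c where "c r = gaussian z (z_hat r) (S r)" for r
  define w where "w = mode_marginal n f_pred"
  define D where "D = (\<Sum>r=1..m. w r * c r)"
  have model: "linear_gaussian_model (n r) nz (P_pred r) (H r) (R r)" if "r \<in> {1..m}" for r
    using assms(4,5,7)[OF that] by unfold_locales
  have S_spd: "sym_pos_def_mat nz (S r)" if "r \<in> {1..m}" for r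
    using linear_gaussian_model.innovation_cov[OF model[OF that]] S[OF that] by simp
  have P_post_spd: "sym_pos_def_mat (n r) (P_post r)" if "r \<in> {1..m}" for r
    using linear_gaussian_model.posterior_cov[OF model[OF that]] S[OF that] P_post[OF that] by simp
  have x_post_carrier: "x_post r \<in> carrier_vec (n r)" if "r \<in> {1..m}" for r
    using assms(3-5)[OF that] unfolding x_post[OF that]
    by (intro add_carrier_vec carrier_vecI) (auto simp: sym_pos_def_mat_def)
  \<comment> \<open>No positivity of the mode probability is required here, so this is available
    also for modes of probability zero.\<close>
  have product: "l z r x * gaussian x (x_pred r) (P_pred r) = c r * gaussian x (x_post r) (P_post r)"
    if r: "r \<in> {1..m}" and x: "x \<in> carrier_vec (n r)" for r x
    using linear_gaussian_model.gaussian_mult_gaussian[OF model[OF r] x assms(3,6)[OF r] assms(8)]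
    unfolding c_def likelihood[OF assms(8) r x] x_post[OF r] P_post[OF r] z_hat[OF r] S[OF r] .
  have c_pos: "c r > 0" if "r \<in> {1..m}" for r
    unfolding c_def by (rule gaussian_pos[OF S_spd[OF that]])
  have pred_nonneg: "f_pred r x \<ge> 0" if "r \<in> {1..m}" "x \<in> carrier_vec (n r)" for r x
    using predicted that by (auto simp: hybrid_density_def)
  have pred_integrable: "integrable (lborel_vec (n r)) (f_pred r)" if "r \<in> {1..m}" for r
    using predicted that by (auto simp: hybrid_density_def)
  have w_nonneg: "w r \<ge> 0" if "r \<in> {1..m}" for r
    unfolding w_def mode_marginal_def
    by (rule Bochner_Integration.integral_nonneg) (use pred_nonneg[OF that] in \<open>simp add: space_lborel_vec\<close>)
  have joint_eq: "l z r x * f_pred r x = w r * c r * gaussian x (x_post r) (P_post r)"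
    if "r \<in> {1..m}" "w r > 0" "x \<in> carrier_vec (n r)" for r x
    using predicted_gaussian[of r x] product[of r x] that by (simp add: w_def mult_ac)
  have joint: "integrable (lborel_vec (n r)) (\<lambda>x. l z r x * f_pred r x) \<and>
      (LINT x|lborel_vec (n r). l z r x * f_pred r x) = w r * c r"
    if r: "r \<in> {1..m}" for r
  proof (cases "w r > 0")
    case True
    have eq: "l z r x * f_pred r x = w r * c r * gaussian x (x_post r) (P_post r)"
      if "x \<in> space (lborel_vec (n r))" for x
      using joint_eq[OF r True] that by (simp add: space_lborel_vec)
    show ?thesis
      using integrable_integral_gaussian[OF P_post_spd[OF r] x_post_carrier[OF r]]
      by (simp add: eq cong: Bochner_Integration.integrable_cong Bochner_Integration.integral_cong)
  next
    \<comment> \<open>The Gaussian form of the prediction is assumed only for modes of positive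
      probability. Here the nonnegative \<open>f_pred r\<close> has integral 0, so it vanishes
      almost everywhere and the joint integral is 0 as well.\<close>
    case False
    then have w0: "w r = 0" using w_nonneg[OF r] by simp
    have "AE x in lborel_vec (n r). f_pred r x \<ge> 0"
      by (rule AE_I2) (simp add: pred_nonneg[OF r] space_lborel_vec)
    then have "AE x in lborel_vec (n r). f_pred r x = 0"
      using integral_nonneg_eq_0_iff_AE[OF pred_integrable[OF r]] w0
      by (simp add: w_def mode_marginal_def)
    then have AE: "AE x in lborel_vec (n r). l z r x * f_pred r x = 0"
      by eventually_elim simp
    text \<open>The product formula writes the likelihood as a quotient of measurable functions.\<close>
    have "l z r x = c r * gaussian x (x_post r) (P_post r) / gaussian x (x_pred r) (P_pred r)"
      if "x \<in> space (lborel_vec (n r))" for x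
      using product[OF r, of x] that gaussian_pos[OF assms(4)[OF r], of x "x_pred r"]
      by (simp add: space_lborel_vec field_simps)
    moreover have "(\<lambda>x. c r * gaussian x (x_post r) (P_post r) / gaussian x (x_pred r) (P_pred r))
        \<in> borel_measurable (lborel_vec (n r))"
      by (intro borel_measurable_divide borel_measurable_times borel_measurable_const
          borel_measurable_gaussian P_post_spd x_post_carrier assms(3,4) r)
    ultimately have "l z r \<in> borel_measurable (lborel_vec (n r))"
      by (simp cong: measurable_cong)
    then have meas: "(\<lambda>x. l z r x * f_pred r x) \<in> borel_measurable (lborel_vec (n r))"
      using pred_integrable[OF r] by simp
    show ?thesis
      using integrable_cong_AE[OF meas borel_measurable_const AE] integral_cong_AE[OF meas borel_measurable_const AE]
      by (simp add: w0)
  qed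
  have evidence: "hybrid_integral m n (\<lambda>r x. l z r x * f_pred r x) = D"
    unfolding hybrid_integral_def D_def using joint by (intro sum.cong refl) auto
  have D_pos: "D > 0"
  proof -
    \<comment> \<open>The mode probabilities sum to 1, so some mode has positive weight and
      contributes a positive term to \<open>D\<close>.\<close>
    have "(\<Sum>r=1..m. w r) = 1"
      using predicted by (simp add: hybrid_density_def hybrid_integral_def w_def mode_marginal_def)
    then obtain r where r: "r \<in> {1..m}" "w r \<noteq> 0" by (metis sum.neutral zero_neq_one)
    then have "0 < w r * c r" using w_nonneg[of r] c_pos[of r] by simp
    also have "\<dots> \<le> D"
      unfolding D_def using r w_nonneg c_pos by (intro member_le_sum) (auto intro!: mult_nonneg_nonneg intro: less_imp_le)
    finally show ?thesis .
  qed
  have post: "f_post r x = l z r x * f_pred r x / D" for r x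
    unfolding posterior bayes_posterior_def evidence ..
  have post_integrable: "integrable (lborel_vec (n r)) (f_post r)" if "r \<in> {1..m}" for r
    using joint[OF that] by (simp add: post[abs_def])
  have marginal: "mode_marginal n f_post r = w r * c r / D" if "r \<in> {1..m}" for r
    using joint[OF that] by (simp add: mode_marginal_def post)
  have post_nonneg: "f_post r x \<ge> 0" if "r \<in> {1..m}" "x \<in> carrier_vec (n r)" for r x
    unfolding post likelihood[OF assms(8) that]
    using pred_nonneg[OF that] D_pos gaussian_pos[OF assms(7)[OF that(1)]]
    by (intro divide_nonneg_nonneg mult_nonneg_nonneg) (auto intro: less_imp_le)
  have "hybrid_integral m n f_post = (\<Sum>r=1..m. w r * c r / D)"
    unfolding hybrid_integral_def using marginal by (intro sum.cong refl) (simp add: mode_marginal_def)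
  also have "\<dots> = 1" using D_pos by (simp add: D_def sum_divide_distrib[symmetric])
  finally have "hybrid_density m n f_post"
    using post_nonneg post_integrable by (auto simp: hybrid_density_def)
  moreover have "f_post r x = mode_marginal n f_post r * state_conditional n f_post r x \<and>
      state_conditional n f_post r x = gaussian x (x_post r) (P_post r)"
    if "r \<in> {1..m}" "mode_marginal n f_pred r > 0" "x \<in> carrier_vec (n r)" for r x
  proof -
    \<comment> \<open>These make the posterior mode probability \<open>w r * c r / D\<close>
      nonzero, so dividing by it leaves exactly the Gaussian factor.\<close>
    have "w r > 0" "c r > 0" using that c_pos by (simp_all add: w_def)
    then show ?thesis
      using joint_eq[of r x] that marginal[of r] D_pos by (simp add: state_conditional_def post w_def)
  qed
  ultimately show ?thesis
    using S_spd P_post_spd marginal by (simp add: w_def c_def D_def)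
qed

end
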